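(* Let $n\geqslant 2$, $r\geqslant 1$ and $s\geqslant 0$ be integers. Then \begin{align*} \sum_{k=0}^{n-1}(-1)^k q^{2k^2+(2r-4s-4)k}[4k+1]_q^{2s}[4k+1]_{q^2} \frac{(q^2;q^4)_k^{2r-1}}{(q^4;q^4)_k^{2r-1}} &\equiv 0 \pmod{A_n(q^2)C_n(q^2)},\\ \sum_{k=0}^{n-1}q^{(2r-4s-4)k}[4k+1]_q^{2s}[4k+1]_{q^2} \frac{(q^2;q^4)_k^{2r}}{(q^4;q^4)_k^{2r}} &\equiv 0 \pmod{A_n(q^2)C_n(q^2)}. \end{align*}
   Context: $(a;q)_m=(1-a)(1-aq)\cdots(1-aq^{m-1})$, $(a;q)_0=1$; $[m]_q=1+q+\cdots+q^{m-1}$. $\Phi_d(q)$ denotes the $d$-th cyclotomic polynomial. For rational functions $A,B$ and polynomial $P$, $A\equiv B\pmod{P}$ means $A-B=P\,U/V$ with $U,V$ polynomials and $V$ coprime to $P$. For a positive integer $n$, let $\mathcal{S}(n)$ be the set of odd integers $d\geqslant 3$ with $\left\lfloor\frac{n-(d+1)/2}{d}\right\rfloor=\left\lfloor\frac{n}{d}\right\rfloor$, and define $A_n(q)=\prod_{d\in\mathcal{S}(n)}\Phi_d(q)$ and $C_n(q)=\prod_{d\mid n,\ d>1,\ d\text{ odd}}\Phi_d(q)$. *)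

theory Defs
  imports
    Complex_Main
    "HOL-Computational_Algebra.Computational_Algebra"
begin

text \<open>
  Polynomials in the indeterminate \<open>q\<close> are taken over the rationals, rational functions are
  elements of the fraction field \<^typ>\<open>rat poly fract\<close>, and \<open>\<q>\<close> is \<open>q\<close> as a rational function.
\<close>

definition qvar :: "rat poly fract"  (\<open>\<q>\<close>)
  where "\<q> = to_fract [:0, 1:]"

definition qpochhammer :: "'a::comm_ring_1 \<Rightarrow> 'a \<Rightarrow> nat \<Rightarrow> 'a"
  where "qpochhammer a x m = (\<Prod>i<m. 1 - a * x ^ i)"

definition qinteger :: "'a::comm_ring_1 \<Rightarrow> nat \<Rightarrow> 'a"
  where "qinteger x m = (\<Sum>i<m. x ^ i)"

text \<open>
  The cyclotomic polynomials are defined over the rationals by recursion on proper divisors, from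
  \<open>q\<^sup>n - 1 = (\<Prod>d dvd n. \<Phi>\<^sub>d(q))\<close>. Lemma \<open>cyclotomic_eq_prod_primitive_roots\<close> below identifies
  them with the product over the primitive roots of unity.
\<close>

fun cyclotomic :: "nat \<Rightarrow> rat poly"
  where "cyclotomic n = (monom 1 n - 1) div (\<Prod>d \<in> {d \<in> {..<n}. d dvd n}. cyclotomic d)"

declare cyclotomic.simps [simp del]

definition primitive_roots :: "nat \<Rightarrow> complex set"
  where "primitive_roots n = {z. z ^ n = 1 \<and> (\<forall>m. 0 < m \<and> m < n \<longrightarrow> z ^ m \<noteq> 1)}"

lemma power_eq_1_iff_primitive:
  assumes "n > 0"
  shows "z ^ n = 1 \<longleftrightarrow> (\<exists>d. d dvd n \<and> z \<in> primitive_roots d)"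
proof
  assume z: "z ^ n = 1"
  define d where "d = (LEAST m. 0 < m \<and> z ^ m = 1)"
  have d: "0 < d \<and> z ^ d = 1"
    unfolding d_def by (rule LeastI[of _ n]) (use assms z in auto)
  have min: "z ^ m \<noteq> 1" if "0 < m" "m < d" for m
    using that not_less_Least[of m "\<lambda>m. 0 < m \<and> z ^ m = 1"] by (auto simp: d_def)
  have "z ^ n = z ^ (d * (n div d) + n mod d)"
    by simp
  also have "\<dots> = z ^ (n mod d)"
    using d by (simp only: power_add power_mult) simp
  finally have "z ^ (n mod d) = 1"
    using z by simp
  hence "n mod d = 0"
    using min[of "n mod d"] d by auto
  thus "\<exists>d. d dvd n \<and> z \<in> primitive_roots d"
    using d min by (auto simp: primitive_roots_def intro!: exI[of _ d])
next
  assume "\<exists>d. d dvd n \<and> z \<in> primitive_roots d"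
  thus "z ^ n = 1"
    by (auto simp: primitive_roots_def dvd_def power_mult)
qed

lemma primitive_roots_disjoint:
  assumes "z \<in> primitive_roots c" "z \<in> primitive_roots d" "c > 0" "d > 0"
  shows "c = d"
  using assms by (auto simp: primitive_roots_def) (metis linorder_neqE_nat)

lemma finite_primitive_roots:
  assumes "n > 0"
  shows "finite (primitive_roots n)"
proof (rule finite_subset)
  show "primitive_roots n \<subseteq> {z. z ^ n = 1}"
    by (auto simp: primitive_roots_def)
  show "finite {z::complex. z ^ n = 1}"
    using finite_roots_unity[of n, where ?'a = complex] assms by auto
qed

lemma monom_minus_1_eq_prod_roots:
  assumes "n > 0"
  shows "monom 1 n - 1 = (\<Prod>z | z ^ n = 1. [:- z, 1:] :: complex poly)"
proof -
  let ?p = "monom 1 n - 1 :: complex poly"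
  have rsf: "rsquarefree ?p"
    unfolding rsquarefree_roots using assms
    by (auto simp: poly_monom pderiv_diff pderiv_monom power_0_left)
  have "coeff ?p n = 1"
    using assms by simp
  moreover have "degree ?p = n"
  proof (rule antisym)
    show "degree ?p \<le> n"
      by (rule degree_diff_le) (auto simp: degree_monom_le)
    show "n \<le> degree ?p"
      by (rule le_degree) (use assms in simp)
  qed
  ultimately have "lead_coeff ?p = 1"
    by simp
  with complex_poly_decompose_rsquarefree[OF rsf] show ?thesis
    by (simp add: poly_monom)
qed

lemma monom_minus_1_eq_prod_primitive:
  assumes "n > 0"
  shows "monom 1 n - 1 = (\<Prod>d | d dvd n. \<Prod>z\<in>primitive_roots d. [:- z, 1:])"
proof -
  have "{z. z ^ n = 1} = (\<Union>d\<in>{d. d dvd n}. primitive_roots d)"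
    using power_eq_1_iff_primitive[OF assms] by auto
  moreover have "(\<Prod>z\<in>(\<Union>d\<in>{d. d dvd n}. primitive_roots d). [:- z, 1:]) =
      (\<Prod>d | d dvd n. \<Prod>z\<in>primitive_roots d. [:- z, 1:])"
  proof (rule prod.UNION_disjoint)
    show "finite {d. d dvd n}"
      using assms by (rule finite_divisors_nat)
    have pos: "d > 0" if "d dvd n" for d
      using that assms by (auto intro: Nat.gr0I)
    show "\<forall>i\<in>{d. d dvd n}. finite (primitive_roots i)"
      using pos by (auto intro: finite_primitive_roots)
    show "\<forall>i\<in>{d. d dvd n}. \<forall>j\<in>{d. d dvd n}.
        i \<noteq> j \<longrightarrow> primitive_roots i \<inter> primitive_roots j = {}"
      using pos primitive_roots_disjoint by blast
  qed
  ultimately show ?thesis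
    using monom_minus_1_eq_prod_roots[OF assms] by simp
qed

lemma map_poly_of_rat_add:
  "map_poly (of_rat :: rat \<Rightarrow> complex) (p + q) = map_poly of_rat p + map_poly of_rat q"
  by (rule poly_eqI) (simp add: coeff_map_poly of_rat_add)

lemma map_poly_of_rat_mult:
  "map_poly (of_rat :: rat \<Rightarrow> complex) (p * q) = map_poly of_rat p * map_poly of_rat q"
  by (rule poly_eqI) (simp add: coeff_map_poly coeff_mult of_rat_sum of_rat_mult)

lemma map_poly_of_rat_prod:
  "map_poly (of_rat :: rat \<Rightarrow> complex) (\<Prod>i\<in>A. f i) = (\<Prod>i\<in>A. map_poly of_rat (f i))"
  by (induction A rule: infinite_finite_induct) (simp_all add: map_poly_of_rat_mult)

lemma cyclotomic_eq_prod_primitive_roots: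
  assumes "n > 0"
  shows "map_poly of_rat (cyclotomic n) = (\<Prod>z\<in>primitive_roots n. [:- z, 1:])"
  using assms
proof (induction n rule: less_induct)
  case (less n)
  define M where "M = map_poly (of_rat :: rat \<Rightarrow> complex)"
  define \<Phi> where "\<Phi> d = (\<Prod>z\<in>primitive_roots d. [:- z, 1:])" for d
  define D where "D = {d \<in> {..<n}. d dvd n}"
  define B where "B = (\<Prod>d\<in>D. cyclotomic d)"
  let ?p = "monom 1 n - 1 :: rat poly"
  have fin: "finite D"
    by (simp add: D_def)
  have D: "{d. d dvd n} = insert n D" "n \<notin> D"
    using less.prems by (auto simp: D_def dest: dvd_imp_le)
  have "M (cyclotomic d) = \<Phi> d" if "d \<in> D" for d
    using that less by (auto simp: M_def \<Phi>_def D_def intro!: less.IH Nat.gr0I)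
  hence MB: "M B = (\<Prod>d\<in>D. \<Phi> d)"
    by (simp add: B_def M_def map_poly_of_rat_prod)
  have B0: "M B \<noteq> 0"
    using fin less.prems by (auto simp: MB \<Phi>_def D_def finite_primitive_roots prod_zero_iff Nat.gr0I)
  have Mp: "M ?p = monom 1 n - 1"
    unfolding M_def by (rule poly_eqI) (simp add: coeff_map_poly of_rat_diff)
  have p: "M ?p = M B * \<Phi> n"
    using monom_minus_1_eq_prod_primitive[OF less.prems] fin
    by (simp add: Mp MB D \<Phi>_def mult.commute)
  have "M ?p = M (B * (?p div B) + ?p mod B)"
    by simp
  also have "\<dots> = M B * M (?p div B) + M (?p mod B)"
    by (simp only: M_def map_poly_of_rat_add map_poly_of_rat_mult)
  finally have eq: "M B * (\<Phi> n - M (?p div B)) = M (?p mod B)"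
    by (simp add: p algebra_simps)
  have deg: "degree (M q) = degree q" for q
    unfolding M_def by (rule degree_map_poly) simp
  have "\<Phi> n - M (?p div B) = 0"
  proof (rule ccontr)
    assume nz: "\<Phi> n - M (?p div B) \<noteq> 0"
    hence "M (?p mod B) \<noteq> 0"
      using B0 unfolding eq[symmetric] by simp
    hence "?p mod B \<noteq> 0"
      by (auto simp: M_def)
    moreover have "B \<noteq> 0"
      using B0 by (auto simp: M_def)
    ultimately have "degree (?p mod B) < degree B"
      using degree_mod_less by blast
    moreover have "degree (M B) \<le> degree (M (?p mod B))"
      using nz B0 by (simp add: eq[symmetric] degree_mult_eq)
    ultimately show False
      by (simp add: deg)
  qed
  thus ?case
    by (subst cyclotomic.simps) (simp add: M_def \<Phi>_def B_def D_def)
qed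

definition ratfun_cong :: "rat poly fract \<Rightarrow> rat poly fract \<Rightarrow> rat poly \<Rightarrow> bool"
  where "ratfun_cong a b P \<longleftrightarrow>
    (\<exists>U V. V \<noteq> 0 \<and> coprime V P \<and> a - b = to_fract P * (to_fract U / to_fract V))"

text \<open>
  The brackets are floors of rational numbers, so the left-hand one is negative for
  \<open>d \<ge> 2 * n\<close>; hence \<open>\<S> n\<close> is finite.
\<close>

definition index_set :: "nat \<Rightarrow> nat set"  (\<open>\<S>\<close>)
  where "\<S> n = {d. odd d \<and> d \<ge> 3 \<and>
    \<lfloor>(of_nat n - (of_nat d + 1) / 2) / of_nat d :: rat\<rfloor> = \<lfloor>of_nat n / of_nat d :: rat\<rfloor>}"

lemma finite_index_set: "finite (\<S> n)"
proof (rule finite_subset)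
  show "\<S> n \<subseteq> {..2 * n}"
  proof
    fix d assume d: "d \<in> \<S> n"
    show "d \<in> {..2 * n}"
    proof (rule ccontr)
      assume "d \<notin> {..2 * n}"
      hence "(of_nat d :: rat) > of_nat (2 * n)"
        by (simp only: of_nat_less_iff) simp
      hence "(of_nat n - (of_nat d + 1) / 2) / of_nat d < (0 :: rat)"
        by (intro divide_neg_pos) auto
      hence "\<lfloor>(of_nat n - (of_nat d + 1) / 2) / of_nat d :: rat\<rfloor> < 0"
        by simp
      moreover have "\<lfloor>of_nat n / of_nat d :: rat\<rfloor> \<ge> 0"
        by simp
      ultimately show False
        using d unfolding index_set_def mem_Collect_eq by linarith
    qed
  qed
qed simp

definition A_poly :: "nat \<Rightarrow> rat poly"
  where "A_poly n = (\<Prod>d\<in>\<S> n. cyclotomic d)"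

definition C_poly :: "nat \<Rightarrow> rat poly"
  where "C_poly n = (\<Prod>d | d dvd n \<and> d > 1 \<and> odd d. cyclotomic d)"

definition subst_sq :: "rat poly \<Rightarrow> rat poly"
  where "subst_sq p = p \<circ>\<^sub>p monom 1 2"

end

theory Submission
  imports Defs "HOL-Computational_Algebra.Field_as_Ring"
begin

text \<open>
  The modulus is a product of distinct factors \<open>X\<^sup>2 - z\<close> over \<open>\<complex>\<close>, where \<open>z\<close> runs through primitive
  \<open>d\<close>-th roots of unity with \<open>d = 2 * m + 1\<close> odd and \<open>n mod d = 0\<close> or \<open>n mod d > m\<close>. So it suffices that
  the sum has no pole and vanishes at every \<open>w\<close> with \<open>w\<^sup>2 = z\<close>. There the \<open>(a * d + b)\<close>-th summand is a
  constant depending on \<open>a\<close> times the \<open>b\<close>-th one, for \<open>b < d\<close>. The \<open>b\<close>-th summand is zero for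
  \<open>m < b < d\<close> and antisymmetric under \<open>b \<mapsto> m - b\<close>. Hence each full block of \<open>d\<close> summands cancels, and
  so does the last, incomplete block, because it is empty or contains all \<open>b \<le> m\<close>.
\<close>

section \<open>Rational polynomials at complex points: common roots and divisibility\<close>

definition poly_at :: "rat poly \<Rightarrow> complex \<Rightarrow> complex"
  where "poly_at p z = poly (map_poly of_rat p) z"

lemma map_poly_of_rat_diff:
  "map_poly (of_rat :: rat \<Rightarrow> complex) (p - q) = map_poly of_rat p - map_poly of_rat q"
  by (rule poly_eqI) (simp add: coeff_map_poly of_rat_diff)

lemma poly_at_0 [simp]: "poly_at 0 z = 0"
  and poly_at_1 [simp]: "poly_at 1 z = 1"
  and poly_at_X [simp]: "poly_at [:0, 1:] z = z"
  and poly_at_add [simp]: "poly_at (p + q) z = poly_at p z + poly_at q z"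
  and poly_at_diff [simp]: "poly_at (p - q) z = poly_at p z - poly_at q z"
  and poly_at_mult [simp]: "poly_at (p * q) z = poly_at p z * poly_at q z"
  by (simp_all add: poly_at_def map_poly_pCons map_poly_of_rat_add map_poly_of_rat_diff
      map_poly_of_rat_mult)

text \<open>A Bezout identity over the rationals, evaluated at \<open>z\<close>, would read 0 =
  1.\<close>

lemma coprime_no_common_root:
  assumes "coprime p q" "poly_at p z = 0"
  shows "poly_at q z \<noteq> 0"
proof
  assume "poly_at q z = 0"
  moreover obtain a b where "a * p + b * q = 1"
    using assms(1) bezout_coefficients[of p q] by (metis coprime_imp_gcd_eq_1 surj_pair)
  hence "poly_at (a * p + b * q) z = 1"
    by simp
  ultimately show False
    using assms(2) by simp
qed

text \<open>A common divisor of positive degree has a complex root by the fundamental theorem of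
  algebra, and that root is shared by \<open>p\<close> and \<open>q\<close>.\<close>

lemma coprime_if_no_common_root:
  assumes "q \<noteq> 0" "\<And>z. poly_at p z = 0 \<Longrightarrow> poly_at q z \<noteq> 0"
  shows "coprime p q"
proof (rule ccontr)
  assume "\<not> coprime p q"
  then obtain g where g: "g dvd p" "g dvd q" "\<not> is_unit g"
    by (auto simp: coprime_def)
  define G where "G = map_poly (of_rat :: rat \<Rightarrow> complex) g"
  have "degree G = degree g"
    unfolding G_def by (rule degree_map_poly) simp
  moreover have "degree g \<noteq> 0"
    using g assms(1) by (auto simp: is_unit_iff_degree)
  ultimately have "\<not> constant (poly G)"
    by (simp add: constant_degree)
  then obtain z where "poly_at g z = 0"
    using fundamental_theorem_of_algebra by (auto simp: poly_at_def G_def)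
  hence "poly_at p z = 0" "poly_at q z = 0"
    using g by (auto elim!: dvdE)
  thus False
    using assms(2) by blast
qed

text \<open>Division with remainder over the rationals remains one over the complex numbers, since
  coefficient extension keeps degrees. If \<open>p\<close> divides \<open>q\<close> over the larger
  field, it divides the remainder there too, which is then zero by degree.\<close>

lemma map_poly_of_rat_dvd_iff:
  "map_poly (of_rat :: rat \<Rightarrow> complex) p dvd map_poly of_rat q \<longleftrightarrow> p dvd q"
proof
  define M where "M = map_poly (of_rat :: rat \<Rightarrow> complex)"
  have deg: "degree (M q) = degree q" for q
    unfolding M_def by (rule degree_map_poly) simp
  have M0: "M q = 0 \<longleftrightarrow> q = 0" for q
    by (simp add: M_def map_poly_eq_0_iff)
  assume "map_poly (of_rat :: rat \<Rightarrow> complex) p dvd map_poly of_rat q"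
  hence dvd: "M p dvd M q"
    by (simp add: M_def)
  have "M q = M (p * (q div p) + q mod p)"
    by simp
  also have "\<dots> = M p * M (q div p) + M (q mod p)"
    by (simp only: M_def map_poly_of_rat_add map_poly_of_rat_mult)
  finally have "M p dvd M (q mod p)"
    using dvd by (simp add: dvd_add_right_iff)
  hence "q mod p = 0 \<or> (degree p \<le> degree (q mod p) \<and> q mod p \<noteq> 0)"
    using dvd_imp_degree_le[of "M p" "M (q mod p)"] by (auto simp: deg M0)
  hence "q mod p = 0"
    using degree_mod_less[of p q] dvd by (cases "p = 0") (auto simp: M_def map_poly_eq_0_iff)
  thus "p dvd q"
    by (simp add: dvd_eq_mod_eq_0)
next
  assume "p dvd q"
  thus "map_poly (of_rat :: rat \<Rightarrow> complex) p dvd map_poly of_rat q"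
    by (auto simp: map_poly_of_rat_mult elim!: dvdE)
qed

text \<open>As z is nonzero, its square roots w and -w are distinct, so X^2 - z splits off from
  \<open>p\<close>. The quotient still vanishes at the square roots of every other element of
  \<open>Z\<close>, because X^2 - z does not.\<close>

lemma prod_X_squared_minus_dvd:
  fixes Z :: "complex set"
  assumes "finite Z" "0 \<notin> Z" "\<And>w. w ^ 2 \<in> Z \<Longrightarrow> poly p w = 0"
  shows "(\<Prod>z\<in>Z. [:- z, 0, 1:]) dvd p"
  using assms
proof (induction Z arbitrary: p rule: finite_induct)
  case (insert z Z)
  define w where "w = csqrt z"
  have w: "w ^ 2 = z" "w \<noteq> 0"
    using insert.prems by (auto simp: w_def)
  have quad: "[:- z, 0, 1:] = [:- w, 1:] * [:w, 1:]"
    using w(1) by (simp add: power2_eq_square)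
  have "poly p w = 0" "poly p (- w) = 0"
    using insert.prems w by auto
  then obtain p1 where p1: "p = [:- w, 1:] * p1"
    by (auto simp: poly_eq_0_iff_dvd elim: dvdE)
  with \<open>poly p (- w) = 0\<close> w(2) have "poly p1 (- w) = 0"
    by simp
  then obtain p2 where "p1 = [:w, 1:] * p2"
    by (auto simp: poly_eq_0_iff_dvd elim: dvdE)
  hence p2: "p = [:- z, 0, 1:] * p2"
    by (simp only: p1 quad mult.assoc)
  have "poly p2 u = 0" if "u ^ 2 \<in> Z" for u
  proof -
    have "poly [:- z, 0, 1:] u = u ^ 2 - z"
      by (simp add: power2_eq_square)
    moreover have "u ^ 2 \<noteq> z"
      using that insert.hyps by auto
    moreover have "poly p u = 0"
      using that insert.prems by auto
    ultimately show ?thesis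
      by (simp only: p2 poly_mult) simp
  qed
  hence "(\<Prod>z\<in>Z. [:- z, 0, 1:]) dvd p2"
    using insert by auto
  thus ?case
    unfolding p2 prod.insert[OF insert.hyps] by (intro mult_dvd_mono dvd_refl)
qed simp

section \<open>Values of rational functions at points that are not poles\<close>

text \<open>A relation rather than a function, so that it asserts regularity at \<open>z\<close>
  along with the value. The fraction need not be in lowest terms, which makes the closure rules
  immediate.\<close>

definition has_value :: "rat poly fract \<Rightarrow> complex \<Rightarrow> complex \<Rightarrow> bool"
  where "has_value f z v \<longleftrightarrow>
    (\<exists>U V. f = to_fract U / to_fract V \<and> poly_at V z \<noteq> 0 \<and> v = poly_at U z / poly_at V z)"

lemma has_value_to_fract: "has_value (to_fract p) z (poly_at p z)"
  unfolding has_value_def by (rule exI[of _ p], rule exI[of _ 1]) simp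

lemma has_value_qvar: "has_value \<q> z z"
  using has_value_to_fract[of "[:0, 1:]" z] by (simp add: qvar_def)

lemma has_value_0: "has_value 0 z 0"
  using has_value_to_fract[of 0 z] by simp

lemma has_value_1: "has_value 1 z 1"
  using has_value_to_fract[of 1 z] by simp

lemma has_value_add:
  assumes "has_value f z u" "has_value g z v"
  shows "has_value (f + g) z (u + v)"
proof -
  obtain A B C D where *: "f = to_fract A / to_fract B" "poly_at B z \<noteq> 0"
      "u = poly_at A z / poly_at B z" "g = to_fract C / to_fract D" "poly_at D z \<noteq> 0"
      "v = poly_at C z / poly_at D z"
    using assms unfolding has_value_def by blast
  hence "B \<noteq> 0" "D \<noteq> 0"
    by auto
  with * show ?thesis
    unfolding has_value_def
    by (intro exI[of _ "A * D + C * B"] exI[of _ "B * D"])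
      (simp add: add_frac_eq)
qed

lemma has_value_mult:
  assumes "has_value f z u" "has_value g z v"
  shows "has_value (f * g) z (u * v)"
proof -
  obtain A B C D where *: "f = to_fract A / to_fract B" "poly_at B z \<noteq> 0"
      "u = poly_at A z / poly_at B z" "g = to_fract C / to_fract D" "poly_at D z \<noteq> 0"
      "v = poly_at C z / poly_at D z"
    using assms unfolding has_value_def by blast
  thus ?thesis
    unfolding has_value_def
    by (intro exI[of _ "A * C"] exI[of _ "B * D"]) simp
qed

lemma has_value_uminus:
  assumes "has_value f z u"
  shows "has_value (- f) z (- u)"
  using has_value_mult[OF has_value_to_fract[of "0 - 1" z, unfolded poly_at_diff] assms] by simp

lemma has_value_diff:
  assumes "has_value f z u" "has_value g z v"
  shows "has_value (f - g) z (u - v)"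
  using has_value_add[OF assms(1) has_value_uminus[OF assms(2)]] by simp

lemma has_value_inverse:
  assumes "has_value f z u" "u \<noteq> 0"
  shows "has_value (inverse f) z (inverse u)"
proof -
  obtain A B where "f = to_fract A / to_fract B" "poly_at B z \<noteq> 0" "u = poly_at A z / poly_at B z"
    using assms unfolding has_value_def by blast
  with assms(2) show ?thesis
    unfolding has_value_def by (intro exI[of _ B] exI[of _ A]) simp
qed

lemma has_value_divide:
  assumes "has_value f z u" "has_value g z v" "v \<noteq> 0"
  shows "has_value (f / g) z (u / v)"
  using has_value_mult[OF assms(1) has_value_inverse[OF assms(2,3)]] by (simp add: divide_inverse)

lemma has_value_power:
  assumes "has_value f z u"
  shows "has_value (f ^ n) z (u ^ n)"
  by (induction n) (auto intro: has_value_1 has_value_mult assms)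

lemma has_value_power_int:
  assumes "has_value f z u" "u \<noteq> 0"
  shows "has_value (f powi i) z (u powi i)"
  using assms by (auto simp: power_int_def intro: has_value_power has_value_inverse)

lemma has_value_sum:
  assumes "\<And>i. i \<in> I \<Longrightarrow> has_value (f i) z (u i)"
  shows "has_value (\<Sum>i\<in>I. f i) z (\<Sum>i\<in>I. u i)"
  using assms
  by (induction I rule: infinite_finite_induct) (auto intro: has_value_0 has_value_add)

lemma has_value_prod:
  assumes "\<And>i. i \<in> I \<Longrightarrow> has_value (f i) z (u i)"
  shows "has_value (\<Prod>i\<in>I. f i) z (\<Prod>i\<in>I. u i)"
  using assms
  by (induction I rule: infinite_finite_induct) (auto intro: has_value_1 has_value_mult)

lemma has_value_qinteger:
  assumes "has_value f z u"
  shows "has_value (qinteger f m) z (qinteger u m)"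
  unfolding qinteger_def by (intro has_value_sum has_value_power assms)

lemmas has_value_intros =
  has_value_qvar has_value_0 has_value_1 has_value_uminus has_value_diff has_value_mult
  has_value_power has_value_power_int has_value_sum has_value_prod has_value_qinteger

text \<open>Write \<open>f\<close> in lowest terms U/V. Comparison with a fraction witnessing the
  value 0 gives U(w) = 0, and then V(w) is nonzero by coprimality. Hence P divides U over the
  complex numbers, so over the rationals, and V has no root in common with P.\<close>

lemma ratfun_cong_0I:
  fixes Z :: "complex set"
  assumes Z: "finite Z" "0 \<notin> Z"
    and P: "map_poly of_rat P = (\<Prod>z\<in>Z. [:- z, 0, 1:])"
    and vanish: "\<And>w. w ^ 2 \<in> Z \<Longrightarrow> has_value f w 0"
  shows "ratfun_cong f 0 P"
proof -
  obtain U V where f: "f = to_fract U / to_fract V" and V: "V \<noteq> 0" and UV: "coprime U V"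
  proof
    show "f = to_fract (fst (quot_of_fract f)) / to_fract (snd (quot_of_fract f))"
      by (simp flip: Fract_conv_to_fract)
  qed (simp_all add: snd_quot_of_fract_nonzero coprime_quot_of_fract)
  have root: "poly_at V w \<noteq> 0 \<and> poly_at U w = 0" if w: "w ^ 2 \<in> Z" for w
  proof -
    obtain A B where AB: "f = to_fract A / to_fract B" "poly_at B w \<noteq> 0" "poly_at A w = 0"
      using vanish[OF w] unfolding has_value_def by auto
    have "to_fract V \<noteq> 0" "to_fract B \<noteq> 0"
      using V AB(2) by auto
    hence "to_fract (U * B) = to_fract (A * V)"
      using AB(1) f by (simp add: frac_eq_eq)
    hence "U * B = A * V"
      by (simp only: to_fract_eq_iff)
    hence "poly_at (U * B) w = poly_at (A * V) w"
      by simp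
    with AB have "poly_at U w = 0"
      by simp
    with coprime_no_common_root[OF UV] show ?thesis
      by blast
  qed
  have rootP: "w ^ 2 \<in> Z" if "poly_at P w = 0" for w
    using that Z by (auto simp: poly_at_def P poly_prod power2_eq_square add_eq_0_iff)
  have "map_poly of_rat P dvd map_poly (of_rat :: rat \<Rightarrow> complex) U"
    unfolding P using Z root by (intro prod_X_squared_minus_dvd) (auto simp: poly_at_def)
  hence "P dvd U"
    by (simp only: map_poly_of_rat_dvd_iff)
  then obtain W where W: "U = P * W"
    by (elim dvdE)
  have "coprime P V"
    using V root rootP by (intro coprime_if_no_common_root) auto
  hence "coprime V P"
    by (simp only: coprime_commute)
  thus ?thesis
    unfolding ratfun_cong_def using V W f by (intro exI[of _ W] exI[of _ V]) simp
qed

section \<open>The summand in factored form\<close>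

text \<open>The quotient of the two q-shifted factorials, kept as a product of quotients so that
  single factors can be split off, reflected or shifted by a period.\<close>

definition half_ratio :: "'a::field \<Rightarrow> nat \<Rightarrow> 'a"
  where "half_ratio q k = (\<Prod>i<k. (1 - q ^ (4 * i + 2)) / (1 - q ^ (4 * i + 4)))"

text \<open>
  The summand of the first sum (\<open>e = 1\<close>) and of the second sum (\<open>e = 0\<close>).
\<close>

definition qterm :: "nat \<Rightarrow> nat \<Rightarrow> nat \<Rightarrow> 'a::field \<Rightarrow> nat \<Rightarrow> 'a"
  where "qterm e r s q k = ((-1) ^ k) ^ e
    * q powi (2 * int e * int k ^ 2 + (2 * int r - 4 * int s - 4) * int k)
    * qinteger q (4 * k + 1) ^ (2 * s) * qinteger (q ^ 2) (4 * k + 1)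
    * half_ratio q k ^ (2 * r - e)"

lemma half_ratio_conv_qpochhammer:
  "half_ratio q k = qpochhammer (q ^ 2) (q ^ 4) k / qpochhammer (q ^ 4) (q ^ 4) k"
proof -
  have "q ^ 2 * (q ^ 4) ^ i = q ^ (4 * i + 2)" "q ^ 4 * (q ^ 4) ^ i = q ^ (4 * i + 4)" for i
    by (simp_all add: add.commute flip: power_mult power_add)
  thus ?thesis
    by (simp only: half_ratio_def qpochhammer_def prod_dividef)
qed

lemma one_minus_mult_qinteger: "(1 - x) * qinteger x k = 1 - x ^ k"
  by (simp add: qinteger_def one_diff_power_eq)

text \<open>Permits cancelling 1 - q^k in the fraction field; the polynomials X^k and 1 differ at
  0.\<close>

lemma qvar_power_neq_1:
  assumes "k > 0"
  shows "\<q> ^ k \<noteq> 1"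
proof
  have pow: "\<q> ^ k = to_fract ([:0, 1:] ^ k)"
    unfolding qvar_def by (induction k) (simp_all only: power_0 to_fract_1 power_Suc to_fract_mult)
  assume "\<q> ^ k = 1"
  hence "to_fract ([:0, 1:] ^ k) = to_fract (1 :: rat poly)"
    by (simp only: pow to_fract_1)
  hence "[:0, 1:] ^ k = (1 :: rat poly)"
    by (simp only: to_fract_eq_iff)
  hence "poly ([:0, 1:] ^ k) 0 = poly (1 :: rat poly) 0"
    by (simp only:)
  thus False
    using assms by (simp add: power_0_left)
qed

lemma half_ratio_add:
  "half_ratio q (j + k) =
    half_ratio q j * (\<Prod>i<k. (1 - q ^ (4 * (j + i) + 2)) / (1 - q ^ (4 * (j + i) + 4)))"
  by (induction k) (simp_all add: half_ratio_def)

section \<open>Antisymmetry of the summand at a root of unity\<close>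

text \<open>
  \<open>w\<^sup>2\<close> is a primitive root of unity of odd order \<open>2 * m + 1\<close>; \<open>w\<close> itself has this order
  or twice it.
\<close>

locale odd_root_of_unity =
  fixes w :: complex and m :: nat
  assumes m_pos: "m > 0"
    and power_eq_1_iff: "\<And>j. w ^ (2 * j) = 1 \<longleftrightarrow> (2 * m + 1) dvd j"
begin

lemma nonzero: "w \<noteq> 0"
  using power_eq_1_iff[of "2 * m + 1"] by auto

lemma neq_1: "w \<noteq> 1" "w ^ 2 \<noteq> 1"
  using power_eq_1_iff[of 1] m_pos by auto

lemma power_int_add': "w powi (i + j) = w powi i * w powi j"
  by (simp add: power_int_add nonzero)

text \<open>w^(4m+2) = 1 whether w has order 2m+1 or twice that, so exponents of w only matter
  modulo 4m+2.\<close>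

lemma power_int_cong:
  assumes "4 * int m + 2 dvd i - j"
  shows "w powi i = w powi j"
proof -
  obtain l where l: "i - j = (4 * int m + 2) * l"
    using assms by (elim dvdE)
  have "w powi i = w powi (j + (4 * int m + 2) * l)"
    using l by (simp flip: l)
  also have "\<dots> = w powi j * (w powi (4 * int m + 2)) powi l"
    using nonzero by (simp add: power_int_add power_int_mult)
  also have "w powi (4 * int m + 2) = w powi int (2 * (2 * m + 1))"
    by (simp add: algebra_simps)
  also have "\<dots> = 1"
    unfolding power_int_of_nat using power_eq_1_iff[of "2 * m + 1"] by simp
  finally show ?thesis
    by simp
qed

lemma power_cong:
  assumes "4 * int m + 2 dvd int i - int j"
  shows "w ^ i = w ^ j"
  using power_int_cong[OF assms] by simp

text \<open>The order 2m+1 of w^2 is odd, so the factor 2 in 2(i+1) cancels, and 0 < i+1 <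
  2m+1.\<close>

lemma even_power_neq_1:
  assumes "i < 2 * m"
  shows "w ^ (4 * i + 4) \<noteq> 1"
proof
  assume "w ^ (4 * i + 4) = 1"
  hence "2 * m + 1 dvd 2 * (i + 1)"
    using power_eq_1_iff[of "2 * (i + 1)"] by (simp only: distrib_left) simp
  moreover have "coprime (2 * m + 1) 2"
    by simp
  ultimately have "2 * m + 1 dvd i + 1"
    by (simp only: coprime_dvd_mult_right_iff)
  thus False
    using assms by (auto dest!: dvd_imp_le)
qed

lemma odd_power_neq_1:
  assumes "i < m"
  shows "w ^ (4 * i + 2) \<noteq> 1"
proof
  assume "w ^ (4 * i + 2) = 1"
  hence "2 * m + 1 dvd 2 * i + 1"
    using power_eq_1_iff[of "2 * i + 1"] by (simp add: algebra_simps)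
  thus False
    using assms by (auto dest!: dvd_imp_le)
qed

text \<open>Here w^i = w^(-j), and 1 - w^(-j) = -w^(-j) (1 - w^j).\<close>

lemma one_minus_reflect:
  assumes "i + j = 4 * m + 2"
  shows "1 - w ^ i = - (w powi (- int j)) * (1 - w ^ j)"
proof -
  have "int i - - int j = 4 * int m + 2"
    using assms by linarith
  hence "w ^ i = w powi (- int j)"
    using power_int_cong[of "int i" "- int j"] by simp
  moreover have "w powi (- int j) * w ^ j = 1"
    using nonzero by (simp add: power_int_minus)
  ultimately show ?thesis
    by (simp add: algebra_simps)
qed

text \<open>The exponent of numerator m-1-i and that of denominator i add up to 4m+2. With the
  numerators reversed, each pair collapses to -w^(-(4i+4)), and the numbers 4i+4 for i < m sum to
  2m(m+1).\<close>

lemma half_ratio_m: "half_ratio w m = (-1) ^ m * w powi (- (2 * int m * (int m + 1)))"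
proof -
  have "half_ratio w m =
      (\<Prod>i<m. 1 - w ^ (4 * i + 2)) / (\<Prod>i<m. 1 - w ^ (4 * i + 4))"
    by (simp only: half_ratio_def prod_dividef)
  also have "(\<Prod>i<m. 1 - w ^ (4 * i + 2)) = (\<Prod>i<m. 1 - w ^ (4 * (m - Suc i) + 2))"
    by (rule prod.nat_diff_reindex[symmetric])
  also have "\<dots> = (\<Prod>i<m. - (w powi (- int (4 * i + 4))) * (1 - w ^ (4 * i + 4)))"
    by (intro prod.cong refl one_minus_reflect) auto
  also have "\<dots> = (\<Prod>i<m. - (w powi (- int (4 * i + 4)))) * (\<Prod>i<m. 1 - w ^ (4 * i + 4))"
    by (rule prod.distrib)
  also have "\<dots> / (\<Prod>i<m. 1 - w ^ (4 * i + 4)) = (\<Prod>i<m. - (w powi (- int (4 * i + 4))))"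
    using even_power_neq_1 by (intro nonzero_mult_div_cancel_right) (auto simp: prod_zero_iff)
  also have "(\<Prod>i<j. - (w powi (- int (4 * i + 4)))) =
      (-1) ^ j * w powi (- (2 * int j * (int j + 1)))" for j
  proof (induction j)
    case (Suc j)
    have "- (2 * int (Suc j) * (int (Suc j) + 1)) =
        - (2 * int j * (int j + 1)) + - int (4 * j + 4)"
      by (simp add: algebra_simps)
    hence "w powi (- (2 * int (Suc j) * (int (Suc j) + 1))) =
        w powi (- (2 * int j * (int j + 1))) * w powi (- int (4 * j + 4))"
      by (simp only: power_int_add')
    with Suc show ?case
      by simp
  qed simp
  finally show ?thesis .
qed

text \<open>Induction from \<open>half_ratio_m\<close>. Reflection turns the last factor of
  \<open>half_ratio w (m - k)\<close> into w^(-2) times the inverse of the factor with index k, so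
  removing it multiplies by w^2 and by that factor.\<close>

lemma half_ratio_reflect:
  assumes "k \<le> m"
  shows "half_ratio w (m - k) =
    (-1) ^ m * w powi (2 * int k - 2 * int m * (int m + 1)) * half_ratio w k"
  using assms
proof (induction k)
  case 0
  show ?case
    by (simp add: half_ratio_m) (simp add: half_ratio_def)
next
  case (Suc k)
  define a where "a = 1 - w ^ (4 * k + 2)"
  define b where "b = 1 - w ^ (4 * k + 4)"
  have nz: "a \<noteq> 0" "b \<noteq> 0"
    using odd_power_neq_1[of k] even_power_neq_1[of k] Suc.prems by (auto simp: a_def b_def)
  define c where "c = half_ratio w (m - Suc k)"
  have "half_ratio w (m - k) = half_ratio w (Suc (m - Suc k))"
    using Suc.prems by (simp add: Suc_diff_Suc)
  also have "\<dots> = c * ((1 - w ^ (4 * (m - Suc k) + 2)) / (1 - w ^ (4 * (m - Suc k) + 4)))"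
    unfolding c_def by (simp add: half_ratio_def)
  also have "1 - w ^ (4 * (m - Suc k) + 2) = - (w powi (- int (4 * k + 4))) * b"
    unfolding b_def using Suc.prems by (intro one_minus_reflect) simp
  also have "1 - w ^ (4 * (m - Suc k) + 4) = - (w powi (- int (4 * k + 2))) * a"
    unfolding a_def using Suc.prems by (intro one_minus_reflect) simp
  also have "w powi (- int (4 * k + 4)) = w powi (- int (4 * k + 2)) * w powi (- 2)"
    by (simp add: algebra_simps flip: power_int_add')
  finally have "half_ratio w (m - k) = c * (w powi (- 2) * b / a)"
    using nonzero by simp
  hence *: "c * (w powi (- 2) * b) =
      (-1) ^ m * w powi (2 * int k - 2 * int m * (int m + 1)) * half_ratio w k * a"
    using nz Suc by (simp add: field_simps)
  have "c * b * (w powi (- 2) * w powi 2) =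
      (-1) ^ m * (w powi (2 * int k - 2 * int m * (int m + 1)) * w powi 2) * half_ratio w k * a"
    using arg_cong[OF *, of "\<lambda>x. x * w powi 2"] by (simp only: mult_ac)
  also have "w powi (- 2) * w powi 2 = 1"
    by (subst power_int_add'[symmetric]) simp
  also have "w powi (2 * int k - 2 * int m * (int m + 1)) * w powi 2 =
      w powi (2 * int (Suc k) - 2 * int m * (int m + 1))"
    by (subst power_int_add'[symmetric]) (simp add: algebra_simps)
  finally have "c = (-1) ^ m * w powi (2 * int (Suc k) - 2 * int m * (int m + 1))
      * (half_ratio w k * (a / b))"
    using nz by (simp add: field_simps)
  thus ?case
    by (simp add: half_ratio_def c_def a_def b_def)
qed

text \<open>The numerator with index m is 1 - w^(4m+2) = 0. This annihilates the product even if
  later denominators are zero, as division is total.\<close>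

lemma half_ratio_eq_0:
  assumes "m < k"
  shows "half_ratio w k = 0"
proof -
  have "w ^ (4 * m + 2) = 1"
    using power_eq_1_iff[of "2 * m + 1"] by simp
  thus ?thesis
    using assms unfolding half_ratio_def by (intro prod_zero) auto
qed

lemma qinteger_cong:
  assumes "4 * int m + 2 dvd int i - int j"
  shows "qinteger w i = qinteger w j" "qinteger (w ^ 2) i = qinteger (w ^ 2) j"
proof -
  have "w ^ i = w ^ j"
    by (rule power_cong[OF assms])
  hence "(1 - w) * qinteger w i = (1 - w) * qinteger w j"
    "(1 - w ^ 2) * qinteger (w ^ 2) i = (1 - w ^ 2) * qinteger (w ^ 2) j"
    by (simp_all only: one_minus_mult_qinteger power_commutes flip: power_mult)
      (simp add: power_mult mult.commute[of 2])
  thus "qinteger w i = qinteger w j" "qinteger (w ^ 2) i = qinteger (w ^ 2) j"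
    using neq_1 by auto
qed

lemma qinteger_reflect:
  assumes "k \<le> m"
  shows "qinteger w (4 * (m - k) + 1) = - (w powi (- int (4 * k + 1))) * qinteger w (4 * k + 1)"
    "qinteger (w ^ 2) (4 * (m - k) + 1) =
      - (w powi (- int (8 * k + 2))) * qinteger (w ^ 2) (4 * k + 1)"
proof -
  have 1: "1 - w ^ (4 * (m - k) + 1) = - (w powi (- int (4 * k + 1))) * (1 - w ^ (4 * k + 1))"
    using assms by (intro one_minus_reflect) simp
  \<comment> \<open>In base w^2 the two exponents add up to 8m+4, twice the period, so
    \<open>one_minus_reflect\<close> does not apply and its computation is redone.\<close>
  have "int (8 * (m - k) + 2) - - int (8 * k + 2) = (4 * int m + 2) * 2"
    using assms by simp
  hence "w powi (int (8 * (m - k) + 2)) = w powi (- int (8 * k + 2))"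
    by (intro power_int_cong) (simp only: dvd_triv_left)
  moreover have "w powi (- int (8 * k + 2)) * w ^ (8 * k + 2) = 1"
    by (subst power_int_of_nat[symmetric], subst power_int_add'[symmetric]) simp
  ultimately have 2:
    "1 - w ^ (8 * (m - k) + 2) = - (w powi (- int (8 * k + 2))) * (1 - w ^ (8 * k + 2))"
    by (simp only: power_int_of_nat) (simp add: algebra_simps)
  have sq: "w ^ (8 * j + 2) = (w ^ 2) ^ (4 * j + 1)" for j
  proof -
    have "8 * j + 2 = 2 * (4 * j + 1)"
      by simp
    thus ?thesis
      by (simp only: power_mult)
  qed
  have "(1 - w) * qinteger w (4 * (m - k) + 1) =
      (1 - w) * (- (w powi (- int (4 * k + 1))) * qinteger w (4 * k + 1))"
    unfolding mult.left_commute[of "1 - w"] one_minus_mult_qinteger by (rule 1)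
  thus "qinteger w (4 * (m - k) + 1) = - (w powi (- int (4 * k + 1))) * qinteger w (4 * k + 1)"
    using neq_1(1) by (metis mult_left_cancel right_minus_eq)
  have "(1 - w ^ 2) * qinteger (w ^ 2) (4 * (m - k) + 1) =
      (1 - w ^ 2) * (- (w powi (- int (8 * k + 2))) * qinteger (w ^ 2) (4 * k + 1))"
    unfolding mult.left_commute[of "1 - w ^ 2"] one_minus_mult_qinteger sq[symmetric] by (rule 2)
  thus "qinteger (w ^ 2) (4 * (m - k) + 1) =
      - (w powi (- int (8 * k + 2))) * qinteger (w ^ 2) (4 * k + 1)"
    using neq_1(2) by (metis mult_left_cancel right_minus_eq)
qed

text \<open>The minus sign comes from the q^2-integer. The sign of the q-integer disappears in the
  even power 2s, and the signs from \<open>half_ratio\<close> turn (-1)^(m-k) into (-1)^k if e = 1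
  and disappear if e = 0. The powers of w agree modulo 4m+2.\<close>

lemma qterm_reflect:
  assumes "k \<le> m" "e \<le> 1" "r \<ge> 1"
  shows "qterm e r s w (m - k) = - qterm e r s w k"
proof -
  define E where "E k = 2 * int e * int k ^ 2 + (2 * int r - 4 * int s - 4) * int k" for k
  define h where "h = 2 * int k - 2 * int m * (int m + 1)"
  define Q1 where "Q1 = qinteger w (4 * k + 1) ^ (2 * s)"
  define Q2 where "Q2 = qinteger (w ^ 2) (4 * k + 1)"
  define R where "R = half_ratio w k ^ (2 * r - e)"
  have int_exp: "int (2 * r - e) = 2 * int r - int e"
    using assms by simp
  have mk: "int (m - k) = int m - int k"
    using assms by simp
  have sign: "((-1) ^ (m - k)) ^ e * ((-1) ^ m) ^ (2 * r - e) = ((-1 :: complex) ^ k) ^ e"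
  proof (cases "e = 0")
    case True
    thus ?thesis
      by (simp add: minus_one_power_iff)
  next
    case False
    hence e: "e = 1"
      using assms by simp
    have "odd (2 * r - 1)"
      using assms by simp
    hence "((-1 :: complex) ^ m) ^ (2 * r - 1) = (-1) ^ m"
      by (cases "even m") simp_all
    thus ?thesis
      using assms(1) by (simp add: e minus_one_power_iff)
  qed
  \<comment> \<open>This factorization is what the particular exponent of q in the summand is made
    for.\<close>
  have expo: "E (m - k) + - int (4 * k + 1) * (2 * int s) + - int (8 * k + 2)
      + h * (2 * int r - int e) - E k =
      (4 * int m + 2) * (int e * (int m - int k) - int r * int m - int s - 1)"
    unfolding E_def h_def mk by (simp add: algebra_simps power2_eq_square)
  have "qterm e r s w (m - k) =
      ((-1) ^ (m - k)) ^ e * w powi E (m - k)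
      * ((- (w powi (- int (4 * k + 1)))) ^ (2 * s) * Q1)
      * (- (w powi (- int (8 * k + 2))) * Q2)
      * (((-1) ^ m) ^ (2 * r - e) * (w powi h) ^ (2 * r - e) * R)"
    unfolding qterm_def qinteger_reflect[OF assms(1)] half_ratio_reflect[OF assms(1)]
      E_def h_def Q1_def Q2_def R_def power_mult_distrib ..
  also have "(- (w powi (- int (4 * k + 1)))) ^ (2 * s) = w powi (- int (4 * k + 1) * (2 * int s))"
    unfolding power_mult power2_minus by (simp flip: power_mult add: power_int_power' algebra_simps)
  also have "(w powi h) ^ (2 * r - e) = w powi (h * (2 * int r - int e))"
    by (simp only: power_int_power' int_exp)
  also have "((-1) ^ (m - k)) ^ e * w powi E (m - k)
      * (w powi (- int (4 * k + 1) * (2 * int s)) * Q1)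
      * (- (w powi (- int (8 * k + 2))) * Q2)
      * (((-1) ^ m) ^ (2 * r - e) * w powi (h * (2 * int r - int e)) * R) =
      - (((-1) ^ (m - k)) ^ e * ((-1) ^ m) ^ (2 * r - e)
      * (w powi E (m - k) * w powi (- int (4 * k + 1) * (2 * int s)) * w powi (- int (8 * k + 2))
        * w powi (h * (2 * int r - int e))) * Q1 * Q2 * R)"
    by (simp only: mult_ac mult_minus_left mult_minus_right)
  also have "w powi E (m - k) * w powi (- int (4 * k + 1) * (2 * int s)) * w powi (- int (8 * k + 2))
        * w powi (h * (2 * int r - int e)) =
      w powi (E (m - k) + - int (4 * k + 1) * (2 * int s) + - int (8 * k + 2)
        + h * (2 * int r - int e))"
    by (simp only: power_int_add')
  also have "\<dots> = w powi E k"
    by (intro power_int_cong) (simp only: expo, simp)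
  also note sign
  finally show ?thesis
    unfolding qterm_def E_def Q1_def Q2_def R_def .
qed

lemma sum_qterm_eq_0:
  assumes "m < c" "e \<le> 1" "r \<ge> 1"
  shows "(\<Sum>k<c. qterm e r s w k) = 0"
proof -
  \<comment> \<open>\<open>e \<le> 1\<close> and \<open>r \<ge> 1\<close> make the exponent
    \<open>2 * r - e\<close> positive, so summands beyond m inherit the zero of
    \<open>half_ratio\<close>.\<close>
  have eq: "(\<Sum>k<c. qterm e r s w k) = (\<Sum>k\<le>m. qterm e r s w k)"
    using assms by (intro sum.mono_neutral_right) (auto simp: qterm_def half_ratio_eq_0)
  have "(\<Sum>k\<le>m. qterm e r s w k) = (\<Sum>k\<le>m. qterm e r s w (m - k))"
    by (rule sum.nat_diff_reindex[of "qterm e r s w" "Suc m",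
          unfolded lessThan_Suc_atMost diff_Suc_Suc, symmetric])
  also have "\<dots> = - (\<Sum>k\<le>m. qterm e r s w k)"
    using assms by (simp add: qterm_reflect sum_negf)
  finally have "2 * (\<Sum>k\<le>m. qterm e r s w k) = 0"
    by (simp only: eq_neg_iff_add_eq_0 mult_2)
  thus ?thesis
    by (simp add: eq)
qed

section \<open>Periodicity of the summands and vanishing of the sum\<close>

text \<open>
  In a full period of factors exactly one numerator and one denominator vanish at \<open>w\<close>, namely
  \<open>1 - y ^ (2 * a + 1)\<close> and \<open>1 - y ^ (2 * a + 2)\<close> with \<open>y = \<q> ^ (2 * (2 * m + 1))\<close>; the common
  factor \<open>1 - y\<close> cancels.
\<close>

lemma has_value_half_ratio_period:
  "\<exists>\<alpha>. has_value (half_ratio \<q> (a * (2 * m + 1))) w \<alpha>"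
proof (induction a)
  case 0
  show ?case
    by (auto simp: half_ratio_def intro: has_value_1)
next
  case (Suc a)
  then obtain \<alpha> where \<alpha>: "has_value (half_ratio \<q> (a * (2 * m + 1))) w \<alpha>"
    by blast
  define d where "d = 2 * m + 1"
  define N where "N i = 1 - \<q> ^ (4 * (a * d + i) + 2)" for i
  define D where "D i = 1 - \<q> ^ (4 * (a * d + i) + 4)" for i
  define y where "y = \<q> ^ (2 * d)"
  have wd: "w ^ (2 * d) = 1"
    using power_eq_1_iff[of d] by (simp add: d_def)
  have "w ^ (4 * (a * d + i) + 4) = w ^ (4 * i + 4)" for i
    by (rule power_cong, rule dvdI[of _ _ "2 * int a"]) (simp add: d_def algebra_simps)
  hence D: "has_value (\<Prod>i<2 * m. D i) w (\<Prod>i<2 * m. 1 - w ^ (4 * i + 4))"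
    unfolding D_def by (intro has_value_prod has_value_diff has_value_1)
      (metis has_value_power has_value_qvar)
  \<comment> \<open>The vanishing numerator has index m and exponent 2d(2a+1), the vanishing
    denominator index 2m and exponent 2d(2a+2).\<close>
  have "has_value (\<Prod>i\<in>{..<d} - {m}. N i) w (\<Prod>i\<in>{..<d} - {m}. 1 - w ^ (4 * (a * d + i) + 2))"
    unfolding N_def by (intro has_value_intros)
  hence "has_value ((\<Prod>i\<in>{..<d} - {m}. N i) / (\<Prod>i<2 * m. D i)) w
    ((\<Prod>i\<in>{..<d} - {m}. 1 - w ^ (4 * (a * d + i) + 2)) / (\<Prod>i<2 * m. 1 - w ^ (4 * i + 4)))"
    (is "has_value ?G w ?g")
    using D even_power_neq_1 by (intro has_value_divide) (auto simp: prod_zero_iff)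
  moreover have "has_value (qinteger y (2 * a + 1) / qinteger y (2 * a + 2)) w
    (qinteger (w ^ (2 * d)) (2 * a + 1) / qinteger (w ^ (2 * d)) (2 * a + 2))"
    (is "has_value ?H w ?h")
  proof -
    \<comment> \<open>At w the base y becomes 1, so the q-integer becomes an ordinary positive
      integer.\<close>
    have "qinteger (w ^ (2 * d)) (2 * a + 2) = of_nat (2 * a + 2)"
      by (simp add: wd qinteger_def)
    also have "\<dots> \<noteq> 0"
      by (simp only: of_nat_eq_0_iff)
    finally show ?thesis
      unfolding y_def by (intro has_value_divide has_value_intros)
  qed
  ultimately have "has_value (half_ratio \<q> (a * d) * (?G * ?H)) w (\<alpha> * (?g * ?h))"
    using \<alpha> by (intro has_value_mult) (simp_all only: d_def)
  moreover have "half_ratio \<q> (Suc a * d) = half_ratio \<q> (a * d) * (?G * ?H)"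
  proof -
    have "half_ratio \<q> (Suc a * d) = half_ratio \<q> (a * d) * ((\<Prod>i<d. N i) / (\<Prod>i<d. D i))"
      unfolding N_def D_def prod_dividef[symmetric]
      using half_ratio_add[of \<q> "a * d" d] by (simp add: add.commute)
    moreover have "(\<Prod>i<d. N i) = N m * (\<Prod>i\<in>{..<d} - {m}. N i)"
      by (rule prod.remove) (simp_all add: d_def)
    moreover have "(\<Prod>i<d. D i) = (\<Prod>i<2 * m. D i) * D (2 * m)"
      by (simp add: d_def)
    moreover have "N m = (1 - y) * qinteger y (2 * a + 1)"
      unfolding one_minus_mult_qinteger y_def N_def power_mult[symmetric]
      by (simp add: d_def algebra_simps)
    moreover have "4 * (a * d + 2 * m) + 4 = 2 * d * (2 * a + 2)"
      by (simp add: d_def algebra_simps)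
    hence "D (2 * m) = (1 - y) * qinteger y (2 * a + 2)"
      unfolding one_minus_mult_qinteger y_def D_def power_mult[symmetric] by (simp only:)
    moreover have "1 - y \<noteq> 0"
      using qvar_power_neq_1[of "2 * d"] by (simp add: y_def d_def)
    ultimately show ?thesis
      by simp
  qed
  ultimately show ?case
    by (auto simp only: d_def)
qed

text \<open>The constant must not depend on b: it consists of a sign and a power of the value of
  \<open>half_ratio\<close> after \<open>a\<close> full periods. The other b < d factors repeat
  those of the first period, whose denominators up to index 2m-1 are nonzero at w.\<close>

lemma has_value_qterm:
  "\<exists>\<gamma>. \<forall>b<2 * m + 1. has_value (qterm e r s \<q> (a * (2 * m + 1) + b)) w (\<gamma> * qterm e r s w b)"
proof -
  define d where "d = 2 * m + 1"
  obtain \<alpha> where \<alpha>: "has_value (half_ratio \<q> (a * d)) w \<alpha>"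
    using has_value_half_ratio_period unfolding d_def by blast
  have "has_value (qterm e r s \<q> (a * d + b)) w
      (((-1) ^ a) ^ e * \<alpha> ^ (2 * r - e) * qterm e r s w b)" if b: "b < d" for b
  proof -
    have cong: "4 * int m + 2 dvd int (4 * (a * d + b) + j) - int (4 * b + j)" for j
      by (rule dvdI[of _ _ "2 * int a"]) (simp add: d_def algebra_simps)
    have half: "has_value (half_ratio \<q> (a * d + b)) w (\<alpha> * half_ratio w b)"
      unfolding half_ratio_add half_ratio_def[of w]
    proof (intro has_value_mult \<alpha> has_value_prod)
      fix i assume "i \<in> {..<b}"
      hence den: "w ^ (4 * i + 4) \<noteq> 1"
        using b by (intro even_power_neq_1) (simp add: d_def)
      have period: "w ^ (4 * (a * d + i) + j) = w ^ (4 * i + j)" for j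
        by (rule power_cong, rule dvdI[of _ _ "2 * int a"]) (simp add: d_def algebra_simps)
      have val: "has_value (\<q> ^ (4 * (a * d + i) + j)) w (w ^ (4 * i + j))" for j
        by (subst period[symmetric]) (intro has_value_power has_value_qvar)
      show "has_value ((1 - \<q> ^ (4 * (a * d + i) + 2)) / (1 - \<q> ^ (4 * (a * d + i) + 4))) w
          ((1 - w ^ (4 * i + 2)) / (1 - w ^ (4 * i + 4)))"
        using den by (intro has_value_divide has_value_diff has_value_1 val) simp
    qed
    have "has_value (qterm e r s \<q> (a * d + b)) w
        (((-1) ^ (a * d + b)) ^ e
        * w powi (2 * int e * int (a * d + b) ^ 2 + (2 * int r - 4 * int s - 4) * int (a * d + b))
        * qinteger w (4 * (a * d + b) + 1) ^ (2 * s) * qinteger (w ^ 2) (4 * (a * d + b) + 1)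
        * (\<alpha> * half_ratio w b) ^ (2 * r - e))"
      unfolding qterm_def by (intro has_value_intros half nonzero)
    \<comment> \<open>Uses that d is odd.\<close>
    also have "((-1) ^ (a * d + b) :: complex) = (-1) ^ a * (-1) ^ b"
      by (simp add: d_def minus_one_power_iff)
    also have "qinteger w (4 * (a * d + b) + 1) = qinteger w (4 * b + 1)"
      by (rule qinteger_cong) (rule cong)
    also have "qinteger (w ^ 2) (4 * (a * d + b) + 1) = qinteger (w ^ 2) (4 * b + 1)"
      by (rule qinteger_cong) (rule cong)
    also have "w powi (2 * int e * int (a * d + b) ^ 2
          + (2 * int r - 4 * int s - 4) * int (a * d + b)) =
        w powi (2 * int e * int b ^ 2 + (2 * int r - 4 * int s - 4) * int b)"
    proof (rule power_int_cong)
      have "2 * int e * int (a * d + b) ^ 2 + (2 * int r - 4 * int s - 4) * int (a * d + b)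
          - (2 * int e * int b ^ 2 + (2 * int r - 4 * int s - 4) * int b) =
          2 * int d * (int a * (int e * (int (a * d) + 2 * int b) + (int r - 2 * int s - 2)))"
        by (simp add: algebra_simps power2_eq_square)
      moreover have "2 * int d = 4 * int m + 2"
        by (simp add: d_def)
      ultimately show "4 * int m + 2 dvd
          2 * int e * int (a * d + b) ^ 2 + (2 * int r - 4 * int s - 4) * int (a * d + b)
          - (2 * int e * int b ^ 2 + (2 * int r - 4 * int s - 4) * int b)"
        by simp
    qed
    finally show ?thesis
      unfolding qterm_def power_mult_distrib by (simp only: mult_ac)
  qed
  thus ?thesis
    unfolding d_def by blast
qed

lemma has_value_sum_qterm:
  assumes n: "n mod (2 * m + 1) = 0 \<or> n mod (2 * m + 1) > m" and "e \<le> 1" "r \<ge> 1"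
  shows "has_value (\<Sum>k<n. qterm e r s \<q> k) w 0"
proof -
  define d where "d = 2 * m + 1"
  have "\<forall>a. \<exists>\<gamma>. \<forall>b<d. has_value (qterm e r s \<q> (a * d + b)) w (\<gamma> * qterm e r s w b)"
    unfolding d_def using has_value_qterm by blast
  then obtain \<gamma> where \<gamma>:
    "has_value (qterm e r s \<q> (a * d + b)) w (\<gamma> a * qterm e r s w b)" if "b < d" for a b
    by metis
  \<comment> \<open>Used with c = d for full blocks and with c = n mod d for the last one.\<close>
  have block: "has_value (\<Sum>b<c. qterm e r s \<q> (a * d + b)) w 0"
    if "c = 0 \<or> m < c" "c \<le> d" for a c
  proof -
    have "has_value (\<Sum>b<c. qterm e r s \<q> (a * d + b)) w (\<Sum>b<c. \<gamma> a * qterm e r s w b)"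
      using that by (intro has_value_sum \<gamma>) auto
    thus ?thesis
      using that sum_qterm_eq_0[of c e r s] assms(2,3) by (auto simp flip: sum_distrib_left)
  qed
  have split: "(\<Sum>k<a * d + c. qterm e r s \<q> k) =
      (\<Sum>k<a * d. qterm e r s \<q> k) + (\<Sum>b<c. qterm e r s \<q> (a * d + b))" for a c
    by (induction c) (simp_all add: add.assoc)
  have full: "has_value (\<Sum>k<a * d. qterm e r s \<q> k) w 0" for a
  proof (induction a)
    case (Suc a)
    have "(\<Sum>k<Suc a * d. qterm e r s \<q> k) =
        (\<Sum>k<a * d. qterm e r s \<q> k) + (\<Sum>b<d. qterm e r s \<q> (a * d + b))"
      using split[of a d] by (simp add: add.commute)
    thus ?case
      using has_value_add[OF Suc block[of d a]] by (simp add: d_def)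
  qed (simp add: has_value_0)
  have "(\<Sum>k<n. qterm e r s \<q> k) = (\<Sum>k<n div d * d. qterm e r s \<q> k)
      + (\<Sum>b<n mod d. qterm e r s \<q> (n div d * d + b))"
    using split[of "n div d" "n mod d"] by simp
  thus ?thesis
    using has_value_add[OF full[of "n div d"] block[of "n mod d" "n div d"]] n
    by (simp add: d_def)
qed

end

section \<open>The roots of the modulus and the congruences\<close>

lemma odd_root_of_unity_primitive_roots:
  assumes "w ^ 2 \<in> primitive_roots (2 * m + 1)" "m > 0"
  shows "odd_root_of_unity w m"
proof
  fix j
  define d where "d = 2 * m + 1"
  have z: "(w ^ 2) ^ d = 1" "\<And>i. 0 < i \<Longrightarrow> i < d \<Longrightarrow> (w ^ 2) ^ i \<noteq> 1"
    using assms(1) by (auto simp: primitive_roots_def d_def)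
  have "w ^ (2 * j) = (w ^ 2) ^ (d * (j div d) + j mod d)"
    by (simp only: mult_div_mod_eq power_mult)
  also have "\<dots> = (w ^ 2) ^ (j mod d)"
    by (simp only: power_add power_mult z(1) power_one mult_1_left)
  finally have "w ^ (2 * j) = (w ^ 2) ^ (j mod d)" .
  moreover have "(w ^ 2) ^ (j mod d) = 1 \<longleftrightarrow> j mod d = 0"
    using z(2)[of "j mod d"] by (cases "j mod d = 0") (auto simp: d_def)
  ultimately show "w ^ (2 * j) = 1 \<longleftrightarrow> 2 * m + 1 dvd j"
    by (simp only: d_def dvd_eq_mod_eq_0)
qed (rule assms(2))

text \<open>Both floors equal n div d, and the left one is at most its argument, so (n div d) d +
  (d+1)/2 is at most n. With d = 2m+1 this says that the last block reaches index m.\<close>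

lemma index_set_imp_mod_ge:
  assumes "d \<in> \<S> n"
  shows "d + 1 \<le> 2 * (n mod d)"
proof -
  have d: "d > 0"
    using assms by (simp add: index_set_def)
  have "rat_of_int \<lfloor>(of_nat n - (of_nat d + 1) / 2) / of_nat d :: rat\<rfloor> \<le>
      (of_nat n - (of_nat d + 1) / 2) / of_nat d"
    by (rule of_int_floor_le)
  also have "\<lfloor>(of_nat n - (of_nat d + 1) / 2) / of_nat d :: rat\<rfloor> = int (n div d)"
    using assms by (simp add: index_set_def floor_divide_of_nat_eq)
  finally have "rat_of_nat (n div d) * of_nat d \<le> of_nat n - (of_nat d + 1) / 2"
    using d by (simp add: pos_le_divide_eq)
  hence "2 * (rat_of_nat (n div d) * of_nat d) + of_nat d + 1 \<le> 2 * of_nat n"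
    by (simp add: field_simps)
  hence "rat_of_nat (2 * (n div d * d) + d + 1) \<le> rat_of_nat (2 * n)"
    by simp
  hence "2 * (n div d * d) + d + 1 \<le> 2 * n"
    by (simp only: of_nat_le_iff)
  thus ?thesis
    using div_mult_mod_eq[of n d] by linarith
qed

lemma map_poly_of_rat_subst_sq:
  "map_poly (of_rat :: rat \<Rightarrow> complex) (subst_sq p) = map_poly of_rat p \<circ>\<^sub>p monom 1 2"
proof -
  have "map_poly (of_rat :: rat \<Rightarrow> complex) (monom 1 2) = monom 1 2"
    by (rule poly_eqI) (simp add: coeff_map_poly)
  thus ?thesis
    unfolding subst_sq_def
    by (induction p)
      (simp_all add: pcompose_pCons map_poly_pCons map_poly_of_rat_add map_poly_of_rat_mult)
qed

lemma subst_sq_mult: "subst_sq (p * q) = subst_sq p * subst_sq q"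
  by (simp add: subst_sq_def pcompose_mult)

text \<open>No cyclotomic factor is repeated: n mod d is zero for divisors d of n but positive on
  \<open>\<S> n\<close>.\<close>

lemma A_poly_mult_C_poly:
  assumes "n > 0"
  shows "A_poly n * C_poly n = (\<Prod>d\<in>\<S> n \<union> {d. d dvd n \<and> d > 1 \<and> odd d}. cyclotomic d)"
proof -
  have "\<S> n \<inter> {d. d dvd n \<and> d > 1 \<and> odd d} = {}"
    using index_set_imp_mod_ge by fastforce
  thus ?thesis
    unfolding A_poly_def C_poly_def using assms
    by (subst prod.union_disjoint) (simp_all add: finite_index_set)
qed

text \<open>Over the complex numbers each factor of the modulus is a product of X^2 - z over the
  primitive d-th roots z. These sets are disjoint for different d, so the modulus is a product over
  one set \<open>Z\<close>, as \<open>ratfun_cong_0I\<close> demands.\<close>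

lemma ratfun_cong_sum_qterm:
  assumes "n > 0" "e \<le> 1" "r \<ge> 1"
  shows "ratfun_cong (\<Sum>k<n. qterm e r s \<q> k) 0 (subst_sq (A_poly n) * subst_sq (C_poly n))"
proof -
  define D where "D = \<S> n \<union> {d. d dvd n \<and> d > 1 \<and> odd d}"
  define Z where "Z = (\<Union>d\<in>D. primitive_roots d)"
  have fin: "finite D"
    using assms(1) by (simp add: D_def finite_index_set)
  have D: "odd d" "d > 1" "n mod d = 0 \<or> d < 2 * (n mod d)" if "d \<in> D" for d
    using that index_set_imp_mod_ge[of d n] by (auto simp: D_def index_set_def)
  have pos: "d > 0" if "d \<in> D" for d
    using D(2)[OF that] by simp
  have prim: "finite (primitive_roots d)" "0 \<notin> primitive_roots d" if "d \<in> D" for d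
    using D(2)[OF that] finite_primitive_roots[of d]
    by (auto simp: primitive_roots_def power_0_left)
  have quad: "[:- z, 1:] \<circ>\<^sub>p monom 1 2 = [:- z, 0, 1:]" for z :: complex
    by (simp add: pcompose_pCons monom_altdef power2_eq_square)
  have "map_poly (of_rat :: rat \<Rightarrow> complex) (subst_sq (A_poly n) * subst_sq (C_poly n)) =
      (\<Prod>d\<in>D. map_poly of_rat (cyclotomic d) \<circ>\<^sub>p monom 1 2)"
    using A_poly_mult_C_poly[OF assms(1)]
    by (simp add: D_def map_poly_of_rat_subst_sq map_poly_of_rat_prod pcompose_prod
        flip: subst_sq_mult)
  also have "\<dots> = (\<Prod>d\<in>D. \<Prod>z\<in>primitive_roots d. [:- z, 0, 1:])"
  proof (rule prod.cong[OF refl])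
    fix d assume "d \<in> D"
    hence "d > 0"
      by (rule pos)
    thus "map_poly of_rat (cyclotomic d) \<circ>\<^sub>p monom 1 2 =
        (\<Prod>z\<in>primitive_roots d. [:- z, 0, 1:])"
      by (simp add: cyclotomic_eq_prod_primitive_roots pcompose_prod quad)
  qed
  also have "\<dots> = (\<Prod>z\<in>Z. [:- z, 0, 1:])"
    unfolding Z_def
  proof (rule prod.UNION_disjoint[symmetric])
    show "\<forall>i\<in>D. \<forall>j\<in>D. i \<noteq> j \<longrightarrow> primitive_roots i \<inter> primitive_roots j = {}"
      using primitive_roots_disjoint pos by blast
  qed (use fin prim in auto)
  finally have P: "map_poly of_rat (subst_sq (A_poly n) * subst_sq (C_poly n)) =
    (\<Prod>z\<in>Z. [:- z, 0, 1:])" .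
  show ?thesis
  proof (rule ratfun_cong_0I[OF _ _ P])
    fix w :: complex
    assume "w ^ 2 \<in> Z"
    then obtain d where d: "d \<in> D" "w ^ 2 \<in> primitive_roots d"
      by (auto simp: Z_def)
    define m where "m = d div 2"
    have m: "d = 2 * m + 1" "m > 0"
      using D[OF d(1)] by (auto simp: m_def elim: oddE)
    interpret odd_root_of_unity w m
      by (rule odd_root_of_unity_primitive_roots) (use d m in auto)
    show "has_value (\<Sum>k<n. qterm e r s \<q> k) w 0"
      by (rule has_value_sum_qterm) (use D(3)[OF d(1)] m(1) assms in auto)
  qed (use fin prim in \<open>auto simp: Z_def\<close>)
qed

theorem theorem2p4:
  fixes n r s :: nat
  assumes "n \<ge> 2" and "r \<ge> 1"
  shows "ratfun_cong
      (\<Sum>k = 0..n - 1. (-1) ^ k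
        * \<q> powi (2 * int k ^ 2 + (2 * int r - 4 * int s - 4) * int k)
        * qinteger \<q> (4 * k + 1) ^ (2 * s) * qinteger (\<q> ^ 2) (4 * k + 1)
        * (qpochhammer (\<q> ^ 2) (\<q> ^ 4) k ^ (2 * r - 1)
            / qpochhammer (\<q> ^ 4) (\<q> ^ 4) k ^ (2 * r - 1)))
      0 (subst_sq (A_poly n) * subst_sq (C_poly n)) \<and>
    ratfun_cong
      (\<Sum>k = 0..n - 1. \<q> powi ((2 * int r - 4 * int s - 4) * int k)
        * qinteger \<q> (4 * k + 1) ^ (2 * s) * qinteger (\<q> ^ 2) (4 * k + 1)
        * (qpochhammer (\<q> ^ 2) (\<q> ^ 4) k ^ (2 * r)
            / qpochhammer (\<q> ^ 4) (\<q> ^ 4) k ^ (2 * r)))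
      0 (subst_sq (A_poly n) * subst_sq (C_poly n))"
proof -
  have range: "{0..n - 1} = {..<n}"
    using assms by auto
  \<comment> \<open>The first congruence is the case e = 1, the second e = 0.\<close>
  show ?thesis
    unfolding range
    using ratfun_cong_sum_qterm[of n 1 r s] ratfun_cong_sum_qterm[of n 0 r s] assms
    by (simp add: qterm_def half_ratio_conv_qpochhammer power_divide)
qed

end
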